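(* Let $n\ge1$, let $(\tilde\Omega,\tilde d)$ be a metric space, and let $\Psi^n_{\tilde\Omega}$ be the set of all maps $\psi:[n]\to\tilde\Omega$, where $[n]=\{1,\dots,n\}$. For $\psi_A,\psi_B\in\Psi^n_{\tilde\Omega}$ let $D_{\psi_A,\psi_B}\in\mathbb{R}^{n\times n}$ be the matrix with $(u,v)$ entry $\tilde d(\psi_A(u),\psi_B(v))$. Let $\mathbb{P}^n$ be the set of $n\times n$ permutation matrices and let $\|\cdot\|$ be an arbitrary entry-wise $p$-norm or operator $p$-norm on $\mathbb{R}^{n\times n}$. For $(A,\psi_A),(B,\psi_B)\in\mathbb{R}^{n\times n}\times\Psi^n_{\tilde\Omega}$ define $$d_{\mathbb{P}^n}\big((A,\psi_A),(B,\psi_B)\big)=\min_{P\in\mathbb{P}^n}\Big[\|AP-PB\|+\mathrm{tr}\big(P^\top D_{\psi_A,\psi_B}\big)\Big].$$ Then $d_{\mathbb{P}^n}$ is a pseudometric on $\mathbb{R}^{n\times n}\times\Psi^n_{\tilde\Omega}$.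
   Context: For $p\in\{1,2,\dots\}\cup\{\infty\}$, the entry-wise $p$-norm of $A=[a_{ij}]$ is $(\sum_{i,j}|a_{ij}|^p)^{1/p}$ ($\max|a_{ij}|$ if $p=\infty$); the operator $p$-norm is $\sup_{\|x\|_p=1}\|Ax\|_p$. A pseudometric on a set $\Omega$ is a function $d:\Omega\times\Omega\to\mathbb{R}$ with, for all $x,y,z$: $d(x,y)\ge0$, $d(x,x)=0$, $d(x,y)=d(y,x)$, $d(x,y)\le d(x,z)+d(z,y)$. *)

theory Defs
  imports "HOL-Analysis.Analysis" "HOL-Library.Extended_Nat"
begin

text \<open>
  The index set \<open>[n]\<close> with \<open>n \<ge> 1\<close> is rendered by a finite type \<open>'n\<close>, so that \<open>n = CARD('n)\<close>.
  The exponent \<open>p\<close> ranges over the extended naturals; the definitions of the norms are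
  meaningful for \<open>p \<ge> 1\<close> only.
\<close>

definition pnorm :: "enat \<Rightarrow> ('i::finite \<Rightarrow> real) \<Rightarrow> real" where
  "pnorm p f = (case p of
      enat k \<Rightarrow> root k (\<Sum>i\<in>UNIV. \<bar>f i\<bar> ^ k)
    | \<infinity> \<Rightarrow> Max (range (\<lambda>i. \<bar>f i\<bar>)))"

definition vec_pnorm :: "enat \<Rightarrow> real ^ 'n \<Rightarrow> real" where
  "vec_pnorm p x = pnorm p (\<lambda>i. x $ i)"

definition entrywise_pnorm :: "enat \<Rightarrow> real ^ 'n ^ 'm \<Rightarrow> real" where
  "entrywise_pnorm p A = pnorm p (\<lambda>(i, j). A $ i $ j)"

definition operator_pnorm :: "enat \<Rightarrow> real ^ 'n ^ 'm \<Rightarrow> real" where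
  "operator_pnorm p A = (SUP x\<in>{x. vec_pnorm p x = 1}. vec_pnorm p (A *v x))"

definition permutation_matrices :: "(real ^ 'n ^ 'n) set" where
  "permutation_matrices =
     {P. \<exists>\<pi>. \<pi> permutes UNIV \<and> P = (\<chi> i j. if j = \<pi> i then 1 else 0)}"

lemma finite_permutation_matrices: "finite (permutation_matrices :: (real ^ 'n ^ 'n) set)"
proof -
  have "(permutation_matrices :: (real ^ 'n ^ 'n) set) =
      (\<lambda>\<pi>. \<chi> i j. if j = \<pi> i then 1 else 0) ` {\<pi>. \<pi> permutes (UNIV :: 'n set)}"
    unfolding permutation_matrices_def by blast
  then show ?thesis
    by (metis finite_imageI finite_permutations[OF finite_class.finite_UNIV])
qed

lemma mat_1_in_permutation_matrices: "mat 1 \<in> permutation_matrices"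
  unfolding permutation_matrices_def mat_def
  by (auto intro!: exI[of _ id] permutes_id simp: vec_eq_iff)

definition cross_dist_matrix ::
    "('a \<Rightarrow> 'a \<Rightarrow> real) \<Rightarrow> ('n \<Rightarrow> 'a) \<Rightarrow> ('n \<Rightarrow> 'a) \<Rightarrow> real ^ 'n ^ 'n" where
  "cross_dist_matrix d \<psi>A \<psi>B = (\<chi> u v. d (\<psi>A u) (\<psi>B v))"

text \<open>The minimum is over a finite nonempty set by the two lemmas above.\<close>

definition perm_dist ::
    "(real ^ 'n ^ 'n \<Rightarrow> real) \<Rightarrow> ('a \<Rightarrow> 'a \<Rightarrow> real) \<Rightarrow>
     (real ^ 'n ^ 'n) \<times> ('n \<Rightarrow> 'a) \<Rightarrow> (real ^ 'n ^ 'n) \<times> ('n \<Rightarrow> 'a) \<Rightarrow> real" where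
  "perm_dist N d = (\<lambda>(A, \<psi>A) (B, \<psi>B).
     Min ((\<lambda>P. N (A ** P - P ** B) + trace (transpose P ** cross_dist_matrix d \<psi>A \<psi>B))
          ` permutation_matrices))"

definition pseudometric_on :: "'s set \<Rightarrow> ('s \<Rightarrow> 's \<Rightarrow> real) \<Rightarrow> bool" where
  "pseudometric_on \<Omega> d \<longleftrightarrow>
     (\<forall>x\<in>\<Omega>. \<forall>y\<in>\<Omega>. 0 \<le> d x y) \<and>
     (\<forall>x\<in>\<Omega>. d x x = 0) \<and>
     (\<forall>x\<in>\<Omega>. \<forall>y\<in>\<Omega>. d x y = d y x) \<and>
     (\<forall>x\<in>\<Omega>. \<forall>y\<in>\<Omega>. \<forall>z\<in>\<Omega>. d x y \<le> d x z + d z y)"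

end

theory Submission
  imports Defs
begin

text \<open>
  Entry-wise and operator \<open>p\<close>-norms are seminorms that are invariant under multiplication by a
  permutation matrix on either side. The identity matrix gives distance \<open>0\<close> from a point to itself.
  Symmetry follows by replacing \<open>P\<close> with its inverse, because
  \<open>B P\<^sup>T - P\<^sup>T A = P\<^sup>T (P B - A P) P\<^sup>T\<close>. For the triangle inequality, optimal \<open>P\<close> and \<open>Q\<close> for the
  two legs are composed and \<open>A P Q - P Q B = (A P - P C) Q + P (C Q - Q B)\<close> is used. The trace term
  is the matching cost \<open>\<Sum>i. d (\<psi>A i) (\<psi>B (\<pi> i))\<close>, to which the triangle inequality of \<open>d\<close>
  applies summand by summand.
\<close>

section \<open>The \<open>p\<close>-norm of a finite family\<close>

lemma one_le_enat_cases:
  fixes p :: enat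
  assumes "1 \<le> p"
  obtains k where "0 < k" "p = enat k" | "p = \<infinity>"
  using assms by (cases p) (auto simp: one_enat_def)

lemma pnorm_enat: "pnorm (enat k) f = root k (\<Sum>i\<in>UNIV. \<bar>f i\<bar> ^ k)"
  by (simp add: pnorm_def)

lemma pnorm_infinity: "pnorm \<infinity> f = Max (range (\<lambda>i. \<bar>f i\<bar>))"
  by (simp add: pnorm_def)

lemma pnorm_enat_power:
  assumes "0 < k"
  shows "pnorm (enat k) f ^ k = (\<Sum>i\<in>UNIV. \<bar>f i\<bar> ^ k)"
  using assms by (simp add: pnorm_enat sum_nonneg)

lemma pnorm_mono:
  assumes "1 \<le> p" "\<And>i. \<bar>f i\<bar> \<le> \<bar>g i\<bar>"
  shows "pnorm p f \<le> pnorm p g"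
  using assms(1)
proof (cases rule: one_le_enat_cases)
  case (1 k)
  then show ?thesis
    by (auto simp: pnorm_enat intro!: sum_mono power_mono assms)
next
  case 2
  have "\<bar>f i\<bar> \<le> Max (range (\<lambda>i. \<bar>g i\<bar>))" for i
    by (rule order_trans[OF assms(2)[of i]]) simp
  with 2 show ?thesis
    by (auto simp: pnorm_infinity)
qed

text \<open>One summand is at most the whole sum. Nonnegativity, definiteness and the boundedness of
  the operator norm all rest on this bound.\<close>

lemma abs_le_pnorm:
  assumes "1 \<le> p"
  shows "\<bar>f i\<bar> \<le> pnorm p f"
  using assms
proof (cases rule: one_le_enat_cases)
  case (1 k)
  have "\<bar>f i\<bar> = root k (\<bar>f i\<bar> ^ k)"
    using 1 by (simp add: real_root_power_cancel)
  also have "\<dots> \<le> root k (\<Sum>i\<in>UNIV. \<bar>f i\<bar> ^ k)"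
    using 1 by (intro real_root_le_mono member_le_sum) auto
  finally show ?thesis
    using 1 by (simp add: pnorm_enat)
next
  case 2
  then show ?thesis by (simp add: pnorm_infinity)
qed

lemma pnorm_nonneg:
  assumes "1 \<le> p"
  shows "0 \<le> pnorm p f"
  using order_trans[OF abs_ge_zero abs_le_pnorm[OF assms]] .

lemma pnorm_zero:
  assumes "1 \<le> p"
  shows "pnorm p (\<lambda>i. 0) = 0"
  using assms by (cases rule: one_le_enat_cases) (auto simp: pnorm_enat pnorm_infinity)

lemma pnorm_uminus: "pnorm p (\<lambda>i. - f i) = pnorm p f"
  by (cases p) (simp_all add: pnorm_def)

text \<open>The source of all permutation invariance below: a permutation matrix only relabels the
  indices of the family.\<close>

lemma pnorm_reindex:
  assumes "bij \<sigma>"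
  shows "pnorm p (\<lambda>i. f (\<sigma> i)) = pnorm p f"
proof (cases p)
  case (enat k)
  have "(\<Sum>i\<in>UNIV. \<bar>f (\<sigma> i)\<bar> ^ k) = (\<Sum>i\<in>UNIV. \<bar>f i\<bar> ^ k)"
    using sum.reindex_bij_betw[OF assms] .
  with enat show ?thesis by (simp add: pnorm_enat)
next
  case infinity
  have "range (\<lambda>i. \<bar>f (\<sigma> i)\<bar>) = (\<lambda>i. \<bar>f i\<bar>) ` range \<sigma>"
    by (simp add: image_image)
  also have "\<dots> = range (\<lambda>i. \<bar>f i\<bar>)"
    using assms by (simp add: bij_is_surj)
  finally show ?thesis using infinity by (simp add: pnorm_infinity)
qed

lemma pnorm_eq_0_imp:
  assumes "1 \<le> p" "pnorm p f = 0"
  shows "f i = 0"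
  using abs_le_pnorm[OF assms(1), of f i] assms(2) by simp

text \<open>Even powers are convex on the whole line, odd ones in general only on the half-line,
  which therefore serves both parities.\<close>

lemma convex_power_atLeast_0: "convex_on {0::real..} (\<lambda>x. x ^ k)"
proof (cases "even k")
  case True
  then show ?thesis by (intro convex_on_subset[OF convex_power_even]) auto
next
  case False
  then show ?thesis by (rule convex_power_odd)
qed

text \<open>Minkowski's inequality. For finite exponent, \<open>f\<close> and \<open>g\<close> are
  scaled to norm 1, so that \<open>\<bar>f i\<bar> + \<bar>g i\<bar>\<close> is \<open>a + b\<close>
  times a convex combination of the scaled entries.\<close>

lemma pnorm_triangle:
  assumes "1 \<le> p"
  shows "pnorm p (\<lambda>i. f i + g i) \<le> pnorm p f + pnorm p g"
  using assms
proof (cases rule: one_le_enat_cases)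
  case (1 k)
  define a b where "a = pnorm p f" and "b = pnorm p g"
  have nonneg: "0 \<le> a" "0 \<le> b"
    unfolding a_def b_def by (simp_all add: pnorm_nonneg[OF assms])
  \<comment> \<open>Scaling divides by both norms; if one of them vanishes, its whole family is
    zero.\<close>
  consider "a = 0" | "b = 0" | "0 < a" "0 < b"
    using nonneg by linarith
  then show ?thesis
  proof cases
    case 1
    then have "f i = 0" for i using pnorm_eq_0_imp[OF assms] by (simp add: a_def)
    with nonneg show ?thesis by (simp add: a_def)
  next
    case 2
    then have "g i = 0" for i using pnorm_eq_0_imp[OF assms] by (simp add: b_def)
    with nonneg show ?thesis by (simp add: b_def)
  next
    case 3
    define s t where "s = a / (a + b)" and "t = b / (a + b)"
    have st: "0 \<le> s" "0 \<le> t" "s + t = 1"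
      using 3 by (auto simp: s_def t_def add_divide_distrib[symmetric])
    have sums: "(\<Sum>i\<in>UNIV. (\<bar>f i\<bar> / a) ^ k) = 1" "(\<Sum>i\<in>UNIV. (\<bar>g i\<bar> / b) ^ k) = 1"
      using 1 3
      by (simp_all add: power_divide a_def b_def pnorm_enat_power[symmetric]
          flip: sum_divide_distrib)
    \<comment> \<open>convexity of \<open>x ^ k\<close>, applied to \<open>\<bar>f i\<bar> / a\<close> and \<open>\<bar>g i\<bar> / b\<close> with weights proportional
      to \<open>a\<close> and \<open>b\<close>\<close>
    have pointwise: "\<bar>f i + g i\<bar> ^ k
        \<le> (a + b) ^ k * (s * (\<bar>f i\<bar> / a) ^ k + t * (\<bar>g i\<bar> / b) ^ k)" for i
    proof -
      have "s * (\<bar>f i\<bar> / a) + t * (\<bar>g i\<bar> / b) = (\<bar>f i\<bar> + \<bar>g i\<bar>) / (a + b)"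
        using 3 by (simp add: s_def t_def add_divide_distrib)
      then have "\<bar>f i\<bar> + \<bar>g i\<bar> = (a + b) * (s * (\<bar>f i\<bar> / a) + t * (\<bar>g i\<bar> / b))"
        using 3 by simp
      then have "\<bar>f i + g i\<bar> ^ k \<le> ((a + b) * (s * (\<bar>f i\<bar> / a) + t * (\<bar>g i\<bar> / b))) ^ k"
        by (metis abs_ge_zero abs_triangle_ineq power_mono)
      also have "\<dots> = (a + b) ^ k * (s * (\<bar>f i\<bar> / a) + t * (\<bar>g i\<bar> / b)) ^ k"
        by (simp add: power_mult_distrib)
      also have "(s * (\<bar>f i\<bar> / a) + t * (\<bar>g i\<bar> / b)) ^ k
          \<le> s * (\<bar>f i\<bar> / a) ^ k + t * (\<bar>g i\<bar> / b) ^ k"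
      proof -
        \<comment> \<open>\<open>convex_onD\<close> has its weights in the form \<open>1 - t\<close>
          and \<open>t\<close>.\<close>
        have s: "s = 1 - t" using st by simp
        show ?thesis
          using convex_onD[OF convex_power_atLeast_0[of k], of t "\<bar>f i\<bar> / a" "\<bar>g i\<bar> / b"] st 3
          by (simp add: s)
      qed
      finally show ?thesis using 3 by simp
    qed
    have "(\<Sum>i\<in>UNIV. \<bar>f i + g i\<bar> ^ k)
        \<le> (\<Sum>i\<in>UNIV. (a + b) ^ k * (s * (\<bar>f i\<bar> / a) ^ k + t * (\<bar>g i\<bar> / b) ^ k))"
      by (intro sum_mono pointwise)
    also have "\<dots> = (a + b) ^ k"
      using sums st by (simp add: sum_distrib_left[symmetric] sum.distrib)
    finally have "root k (\<Sum>i\<in>UNIV. \<bar>f i + g i\<bar> ^ k) \<le> root k ((a + b) ^ k)"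
      using 1 by simp
    also have "\<dots> = a + b"
      using 1 3 by (simp add: real_root_power_cancel)
    finally show ?thesis
      using 1 by (simp add: pnorm_enat a_def b_def)
  qed
next
  case 2
  have "\<bar>f i + g i\<bar> \<le> pnorm p f + pnorm p g" for i
    using abs_le_pnorm[OF assms, of f i] abs_le_pnorm[OF assms, of g i] by linarith
  with 2 show ?thesis by (simp add: pnorm_infinity)
qed

section \<open>Permutation matrices\<close>

definition perm_matrix :: "('n \<Rightarrow> 'n) \<Rightarrow> real ^ 'n ^ 'n" where
  "perm_matrix \<pi> = (\<chi> i j. if j = \<pi> i then 1 else 0)"

text \<open>Bijectivity is the form that the reindexing and inverse rules accept.\<close>

lemma permutation_matrices_eq: "permutation_matrices = perm_matrix ` {\<pi>. bij \<pi>}"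
proof -
  have "\<pi> permutes UNIV \<longleftrightarrow> bij \<pi>" for \<pi> :: "'n \<Rightarrow> 'n"
    using bij_imp_permutes permutes_bij by blast
  then show ?thesis
    by (auto simp: permutation_matrices_def perm_matrix_def)
qed

lemma matrix_diff_ldistrib: "A ** (B - C) = A ** B - A ** C"
  for A :: "'a::ring_1 ^ 'n ^ 'm"
  by (simp add: vec_eq_iff matrix_matrix_mult_def right_diff_distrib sum_subtractf)

lemma matrix_diff_rdistrib: "(A - B) ** C = A ** C - B ** C"
  for A :: "'a::ring_1 ^ 'n ^ 'm"
  by (simp add: vec_eq_iff matrix_matrix_mult_def left_diff_distrib sum_subtractf)

lemma perm_matrix_mult_nth: "(perm_matrix \<pi> ** A) $ i $ j = A $ \<pi> i $ j"
  by (simp add: perm_matrix_def matrix_matrix_mult_def if_distrib[of "\<lambda>x. x * _"] cong: if_cong)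

lemma perm_matrix_vector_nth: "(perm_matrix \<pi> *v x) $ i = x $ \<pi> i"
  by (simp add: perm_matrix_def matrix_vector_mult_def if_distrib[of "\<lambda>x. x * _"] cong: if_cong)

lemma mult_perm_matrix_nth:
  assumes "bij \<pi>"
  shows "(A ** perm_matrix \<pi>) $ i $ j = A $ i $ inv \<pi> j"
proof -
  have "j = \<pi> k \<longleftrightarrow> k = inv \<pi> j" for k
    using assms by (metis bij_inv_eq_iff)
  then show ?thesis
    by (simp add: perm_matrix_def matrix_matrix_mult_def if_distrib[of "\<lambda>x. _ * x"] cong: if_cong)
qed

text \<open>The order reverses because row \<open>i\<close> of the product is row
  \<open>\<pi> i\<close> of the right factor, whose one stands in column
  \<open>\<sigma> (\<pi> i)\<close>.\<close>

lemma perm_matrix_mult: "perm_matrix \<pi> ** perm_matrix \<sigma> = perm_matrix (\<sigma> \<circ> \<pi>)"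
  by (simp add: vec_eq_iff perm_matrix_mult_nth) (simp add: perm_matrix_def)

lemma perm_matrix_id: "perm_matrix id = mat 1"
  by (auto simp: perm_matrix_def mat_def vec_eq_iff)

lemma perm_matrix_inv:
  assumes "bij \<pi>"
  shows "perm_matrix \<pi> ** perm_matrix (inv \<pi>) = mat 1"
    and "perm_matrix (inv \<pi>) ** perm_matrix \<pi> = mat 1"
  using assms by (simp_all add: perm_matrix_mult perm_matrix_id bij_is_inj
        surj_iff[THEN iffD1, OF bij_is_surj])

text \<open>The trace is the Frobenius inner product of the two matrices, and row \<open>i\<close>
  of the permutation matrix selects a single entry.\<close>

lemma trace_transpose_perm_matrix:
  "trace (transpose (perm_matrix \<pi>) ** D) = (\<Sum>i\<in>UNIV. D $ i $ \<pi> i)"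
proof -
  have "trace (transpose (perm_matrix \<pi>) ** D)
      = (\<Sum>j\<in>UNIV. \<Sum>i\<in>UNIV. (if j = \<pi> i then 1 else 0) * D $ i $ j)"
    by (simp add: trace_def transpose_def matrix_matrix_mult_def perm_matrix_def)
  also have "\<dots> = (\<Sum>i\<in>UNIV. \<Sum>j\<in>UNIV. (if j = \<pi> i then 1 else 0) * D $ i $ j)"
    by (rule sum.swap)
  also have "\<dots> = (\<Sum>i\<in>UNIV. D $ i $ \<pi> i)"
    by (simp add: if_distrib[of "\<lambda>x. x * _"] cong: if_cong)
  finally show ?thesis .
qed

section \<open>Permutation-invariant seminorms\<close>

text \<open>Collects what the pseudometric argument uses of the norm, so that both kinds of norm are
  handled at once.\<close>

locale perm_invariant_seminorm =
  fixes N :: "real ^ 'n ^ 'n \<Rightarrow> real"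
  assumes nonneg: "0 \<le> N X"
    and zero: "N 0 = 0"
    and uminus: "N (- X) = N X"
    and triangle: "N (X + Y) \<le> N X + N Y"
    and perm_left: "bij \<pi> \<Longrightarrow> N (perm_matrix \<pi> ** X) = N X"
    and perm_right: "bij \<pi> \<Longrightarrow> N (X ** perm_matrix \<pi>) = N X"

section \<open>Entry-wise norms\<close>

lemma perm_invariant_seminorm_entrywise:
  assumes "1 \<le> p"
  shows "perm_invariant_seminorm (entrywise_pnorm p :: real ^ 'n ^ 'n \<Rightarrow> real)"
proof
  fix X Y :: "real ^ 'n ^ 'n" and \<pi> :: "'n \<Rightarrow> 'n"
  show "0 \<le> entrywise_pnorm p X"
    by (simp add: entrywise_pnorm_def pnorm_nonneg[OF assms])
  show "entrywise_pnorm p (0 :: real ^ 'n ^ 'n) = 0"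
    using pnorm_zero[OF assms] by (simp add: entrywise_pnorm_def case_prod_unfold)
  show "entrywise_pnorm p (- X) = entrywise_pnorm p X"
    by (simp add: entrywise_pnorm_def case_prod_unfold pnorm_uminus)
  show "entrywise_pnorm p (X + Y) \<le> entrywise_pnorm p X + entrywise_pnorm p Y"
    by (simp add: entrywise_pnorm_def case_prod_unfold pnorm_triangle[OF assms])
  assume \<pi>: "bij \<pi>"
  \<comment> \<open>Permuting rows or columns is a bijection of the index pairs.\<close>
  have "bij (map_prod \<pi> (id :: 'n \<Rightarrow> 'n))" "bij (map_prod (id :: 'n \<Rightarrow> 'n) (inv \<pi>))"
    using bij_betw_map_prod[of \<pi> UNIV UNIV id UNIV UNIV]
      bij_betw_map_prod[of id UNIV UNIV "inv \<pi>" UNIV UNIV] \<pi> bij_imp_bij_inv[OF \<pi>]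
    by simp_all
  from this[THEN pnorm_reindex, of p "\<lambda>(i, j). X $ i $ j"]
  show "entrywise_pnorm p (perm_matrix \<pi> ** X) = entrywise_pnorm p X"
    and "entrywise_pnorm p (X ** perm_matrix \<pi>) = entrywise_pnorm p X"
    by (simp_all add: entrywise_pnorm_def case_prod_unfold perm_matrix_mult_nth
        mult_perm_matrix_nth[OF \<pi>])
qed

section \<open>Operator norms as suprema over the unit sphere\<close>

lemma vec_pnorm_perm_matrix:
  assumes "bij \<pi>"
  shows "vec_pnorm p (perm_matrix \<pi> *v x) = vec_pnorm p x"
  by (simp add: vec_pnorm_def perm_matrix_vector_nth pnorm_reindex[OF assms])

lemma vec_pnorm_axis:
  assumes "1 \<le> p"
  shows "vec_pnorm p (axis j 1) = 1"
  using assms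
proof (cases rule: one_le_enat_cases)
  case (1 k)
  \<comment> \<open>Here \<open>0 < k\<close> matters: off \<open>j\<close> the summand is
    \<open>0 ^ k\<close>, which would be 1 for \<open>k = 0\<close>.\<close>
  have "(\<Sum>i\<in>UNIV. \<bar>axis j (1::real) $ i\<bar> ^ k) = (\<Sum>i\<in>UNIV. if i = j then 1 else 0)"
    using 1 by (intro sum.cong) (auto simp: axis_def)
  with 1 show ?thesis by (simp add: vec_pnorm_def pnorm_enat)
next
  case 2
  have "Max (range (\<lambda>i. \<bar>axis j (1::real) $ i\<bar>)) = 1"
    by (rule Max_eqI) (auto simp: axis_def intro!: image_eqI[of _ _ j])
  with 2 show ?thesis by (simp add: vec_pnorm_def pnorm_infinity)
qed

text \<open>On the unit sphere all coordinates are at most 1 in absolute value, so the absolute row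
  sums of \<open>A\<close> dominate the entries of \<open>A *v x\<close> uniformly in
  \<open>x\<close>.\<close>

lemma bdd_above_operator_pnorm:
  fixes A :: "real ^ 'n ^ 'm"
  assumes "1 \<le> p"
  shows "bdd_above ((\<lambda>x. vec_pnorm p (A *v x)) ` {x. vec_pnorm p x = 1})"
proof (rule bdd_aboveI2)
  fix x :: "real ^ 'n"
  assume "x \<in> {x. vec_pnorm p x = 1}"
  then have x: "\<bar>x $ j\<bar> \<le> 1" for j
    using abs_le_pnorm[OF assms, of "\<lambda>j. x $ j" j] by (simp add: vec_pnorm_def)
  \<comment> \<open>The outer absolute value matches the premise of
    \<open>pnorm_mono\<close>.\<close>
  have "\<bar>(A *v x) $ i\<bar> \<le> \<bar>\<Sum>j\<in>UNIV. \<bar>A $ i $ j\<bar>\<bar>" for i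
  proof -
    have "\<bar>(A *v x) $ i\<bar> \<le> (\<Sum>j\<in>UNIV. \<bar>A $ i $ j * x $ j\<bar>)"
      by (simp add: matrix_vector_mult_def)
    also have "\<dots> \<le> (\<Sum>j\<in>UNIV. \<bar>A $ i $ j\<bar>)"
      using x by (intro sum_mono) (simp add: abs_mult mult_left_le)
    finally show ?thesis by linarith
  qed
  then show "vec_pnorm p (A *v x) \<le> pnorm p (\<lambda>i. \<Sum>j\<in>UNIV. \<bar>A $ i $ j\<bar>)"
    unfolding vec_pnorm_def by (rule pnorm_mono[OF assms])
qed

lemma vec_pnorm_le_operator_pnorm:
  assumes "1 \<le> p" "vec_pnorm p x = 1"
  shows "vec_pnorm p (A *v x) \<le> operator_pnorm p A"
  unfolding operator_pnorm_def
  using assms by (intro cSUP_upper bdd_above_operator_pnorm) auto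

lemma operator_pnorm_least:
  fixes A :: "real ^ 'n ^ 'm"
  assumes "1 \<le> p" "\<And>x. vec_pnorm p x = 1 \<Longrightarrow> vec_pnorm p (A *v x) \<le> c"
  shows "operator_pnorm p A \<le> c"
proof -
  \<comment> \<open>Any index will do; the point is that the unit sphere is nonempty, as
    \<open>cSUP_least\<close> requires.\<close>
  have "(axis undefined 1 :: real ^ 'n) \<in> {x. vec_pnorm p x = 1}"
    using vec_pnorm_axis[OF assms(1)] by simp
  then show ?thesis
    unfolding operator_pnorm_def using assms(2) by (intro cSUP_least) auto
qed

lemma perm_invariant_seminorm_operator:
  assumes p: "1 \<le> p"
  shows "perm_invariant_seminorm (operator_pnorm p :: real ^ 'n ^ 'n \<Rightarrow> real)"
proof
  fix X Y :: "real ^ 'n ^ 'n" and \<pi> :: "'n \<Rightarrow> 'n"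
  show nonneg: "0 \<le> operator_pnorm p X" for X :: "real ^ 'n ^ 'n"
    using vec_pnorm_le_operator_pnorm[OF p vec_pnorm_axis[OF p]]
      pnorm_nonneg[OF p] order_trans unfolding vec_pnorm_def by metis
  show "operator_pnorm p (0 :: real ^ 'n ^ 'n) = 0"
  proof (rule antisym[OF operator_pnorm_least[OF p] nonneg])
    show "vec_pnorm p ((0 :: real ^ 'n ^ 'n) *v x) \<le> 0" for x
      by (simp add: vec_pnorm_def pnorm_zero[OF p])
  qed
  have "(- X) *v x = - (X *v x)" for x
    by (simp add: vec_eq_iff matrix_vector_mult_def sum_negf)
  then show "operator_pnorm p (- X) = operator_pnorm p X"
    by (simp add: operator_pnorm_def vec_pnorm_def pnorm_uminus)
  show "operator_pnorm p (X + Y) \<le> operator_pnorm p X + operator_pnorm p Y"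
  proof (rule operator_pnorm_least[OF p])
    fix x :: "real ^ 'n"
    assume x: "vec_pnorm p x = 1"
    have "vec_pnorm p ((X + Y) *v x) \<le> vec_pnorm p (X *v x) + vec_pnorm p (Y *v x)"
      by (simp add: vec_pnorm_def matrix_vector_mult_add_rdistrib pnorm_triangle[OF p])
    then show "vec_pnorm p ((X + Y) *v x) \<le> operator_pnorm p X + operator_pnorm p Y"
      using vec_pnorm_le_operator_pnorm[OF p x, of X] vec_pnorm_le_operator_pnorm[OF p x, of Y]
      by linarith
  qed
  assume \<pi>: "bij \<pi>"
  \<comment> \<open>Only the coordinates of \<open>X *v x\<close> are permuted, so the function
    under the supremum is unchanged.\<close>
  show "operator_pnorm p (perm_matrix \<pi> ** X) = operator_pnorm p X"
    by (simp add: operator_pnorm_def vec_pnorm_perm_matrix[OF \<pi>]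
        flip: matrix_vector_mul_assoc)
  \<comment> \<open>On the right the matrix moves the argument within the unit sphere, which gives
    one inequality; the inverse permutation gives the other.\<close>
  have le: "operator_pnorm p (Z ** perm_matrix \<sigma>) \<le> operator_pnorm p Z"
    if "bij \<sigma>" for Z :: "real ^ 'n ^ 'n" and \<sigma>
    by (intro operator_pnorm_least[OF p])
      (simp add: vec_pnorm_le_operator_pnorm[OF p] vec_pnorm_perm_matrix[OF that]
        flip: matrix_vector_mul_assoc)
  show "operator_pnorm p (X ** perm_matrix \<pi>) = operator_pnorm p X"
    using le[OF \<pi>, of X] le[OF bij_imp_bij_inv[OF \<pi>], of "X ** perm_matrix \<pi>"]
    by (simp add: perm_matrix_inv[OF \<pi>] flip: matrix_mul_assoc)
qed

section \<open>The pseudometric\<close>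

definition perm_cost ::
    "(real ^ 'n ^ 'n \<Rightarrow> real) \<Rightarrow> ('a \<Rightarrow> 'a \<Rightarrow> real) \<Rightarrow>
     real ^ 'n ^ 'n \<Rightarrow> ('n \<Rightarrow> 'a) \<Rightarrow> real ^ 'n ^ 'n \<Rightarrow> ('n \<Rightarrow> 'a) \<Rightarrow> ('n \<Rightarrow> 'n) \<Rightarrow> real" where
  "perm_cost N d A \<psi>A B \<psi>B \<pi> =
     N (A ** perm_matrix \<pi> - perm_matrix \<pi> ** B) + (\<Sum>i\<in>UNIV. d (\<psi>A i) (\<psi>B (\<pi> i)))"

lemma perm_dist_eq: "perm_dist N d (A, \<psi>A) (B, \<psi>B) = Min (perm_cost N d A \<psi>A B \<psi>B ` {\<pi>. bij \<pi>})"
  by (simp add: perm_dist_def permutation_matrices_eq image_image trace_transpose_perm_matrix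
      cross_dist_matrix_def perm_cost_def[abs_def])

lemma perm_dist_le:
  assumes "bij \<pi>"
  shows "perm_dist N d (A, \<psi>A) (B, \<psi>B) \<le> perm_cost N d A \<psi>A B \<psi>B \<pi>"
  using assms by (auto simp: perm_dist_eq intro!: Min_le)

text \<open>A minimum over a finite nonempty set is one of its values, so bounds on distances reduce
  to bounds on the cost of single permutations.\<close>

lemma perm_dist_attained:
  obtains \<pi> where "bij \<pi>" "perm_dist N d (A, \<psi>A) (B, \<psi>B) = perm_cost N d A \<psi>A B \<psi>B \<pi>"
proof -
  have "perm_cost N d A \<psi>A B \<psi>B ` {\<pi>. bij \<pi>} \<noteq> {}"
    using bij_id by blast
  then have "perm_dist N d (A, \<psi>A) (B, \<psi>B) \<in> perm_cost N d A \<psi>A B \<psi>B ` {\<pi>. bij \<pi>}"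
    unfolding perm_dist_eq by (intro Min_in) auto
  then show thesis using that by auto
qed

context perm_invariant_seminorm
begin

lemma perm_cost_inv:
  assumes "\<And>x y. d x y = d y x" and \<pi>: "bij \<pi>"
  shows "perm_cost N d B \<psi>B A \<psi>A (inv \<pi>) = perm_cost N d A \<psi>A B \<psi>B \<pi>"
proof -
  let ?P = "perm_matrix \<pi>" and ?Q = "perm_matrix (inv \<pi>)"
  \<comment> \<open>Multiplying by \<open>?P\<close> on both sides keeps the norm and lets each
    \<open>?Q\<close> cancel against a \<open>?P\<close>.\<close>
  have "?P ** (B ** ?Q - ?Q ** A) ** ?P = ?P ** B ** (?Q ** ?P) - (?P ** ?Q) ** A ** ?P"
    by (simp add: matrix_mul_assoc matrix_diff_ldistrib matrix_diff_rdistrib)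
  also have "\<dots> = - (A ** ?P - ?P ** B)"
    by (simp add: perm_matrix_inv[OF \<pi>])
  finally have "N (B ** ?Q - ?Q ** A) = N (A ** ?P - ?P ** B)"
    by (metis perm_left[OF \<pi>] perm_right[OF \<pi>] uminus)
  \<comment> \<open>Substitute \<open>\<pi> i\<close> for \<open>i\<close>, then swap the arguments
    of \<open>d\<close>.\<close>
  moreover have "(\<Sum>i\<in>UNIV. d (\<psi>B i) (\<psi>A (inv \<pi> i))) = (\<Sum>i\<in>UNIV. d (\<psi>A i) (\<psi>B (\<pi> i)))"
    using sum.reindex_bij_betw[OF \<pi>, of "\<lambda>i. d (\<psi>B i) (\<psi>A (inv \<pi> i))"] assms(1) \<pi>
    by (simp add: bij_is_inj)
  ultimately show ?thesis by (simp add: perm_cost_def)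
qed

text \<open>The triangle inequality is assumed only at values of the three maps, since
  \<open>Metric_space\<close> grants it only on the carrier.\<close>

lemma perm_cost_comp:
  assumes "\<And>i j k. d (\<psi>A i) (\<psi>B k) \<le> d (\<psi>A i) (\<psi>C j) + d (\<psi>C j) (\<psi>B k)"
    and \<pi>: "bij \<pi>" and \<sigma>: "bij \<sigma>"
  shows "perm_cost N d A \<psi>A B \<psi>B (\<sigma> \<circ> \<pi>)
    \<le> perm_cost N d A \<psi>A C \<psi>C \<pi> + perm_cost N d C \<psi>C B \<psi>B \<sigma>"
proof -
  let ?P = "perm_matrix \<pi>" and ?Q = "perm_matrix \<sigma>"
  \<comment> \<open>The mixed terms \<open>?P ** C ** ?Q\<close> cancel.\<close>
  have "A ** perm_matrix (\<sigma> \<circ> \<pi>) - perm_matrix (\<sigma> \<circ> \<pi>) ** B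
      = (A ** ?P - ?P ** C) ** ?Q + ?P ** (C ** ?Q - ?Q ** B)"
    by (simp add: matrix_mul_assoc matrix_diff_ldistrib matrix_diff_rdistrib
        flip: perm_matrix_mult)
  then have "N (A ** perm_matrix (\<sigma> \<circ> \<pi>) - perm_matrix (\<sigma> \<circ> \<pi>) ** B)
      \<le> N (A ** ?P - ?P ** C) + N (C ** ?Q - ?Q ** B)"
    by (metis triangle perm_left[OF \<pi>] perm_right[OF \<sigma>])
  moreover have "(\<Sum>i\<in>UNIV. d (\<psi>A i) (\<psi>B (\<sigma> (\<pi> i))))
      \<le> (\<Sum>i\<in>UNIV. d (\<psi>A i) (\<psi>C (\<pi> i))) + (\<Sum>i\<in>UNIV. d (\<psi>C i) (\<psi>B (\<sigma> i)))"
  proof -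
    have "(\<Sum>i\<in>UNIV. d (\<psi>A i) (\<psi>B (\<sigma> (\<pi> i))))
        \<le> (\<Sum>i\<in>UNIV. d (\<psi>A i) (\<psi>C (\<pi> i)) + d (\<psi>C (\<pi> i)) (\<psi>B (\<sigma> (\<pi> i))))"
      by (intro sum_mono assms)
    then show ?thesis
      \<comment> \<open>The second leg is summed along \<open>\<pi>\<close>; reindexing restores the
        matching cost of \<open>\<sigma>\<close>.\<close>
      using sum.reindex_bij_betw[OF \<pi>, of "\<lambda>i. d (\<psi>C i) (\<psi>B (\<sigma> i))"]
      by (simp add: sum.distrib)
  qed
  ultimately show ?thesis by (simp add: perm_cost_def)
qed

theorem pseudometric_on_perm_dist:
  assumes "Metric_space M d"
  shows "pseudometric_on (UNIV \<times> (UNIV \<rightarrow> M)) (perm_dist N d)"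
proof -
  interpret Met: Metric_space M d by fact
  have dist_nonneg: "0 \<le> perm_dist N d x y" for x y
  proof -
    obtain A \<psi>A B \<psi>B where xy: "x = (A, \<psi>A)" "y = (B, \<psi>B)" by (metis surj_pair)
    obtain \<pi> where "perm_dist N d (A, \<psi>A) (B, \<psi>B) = perm_cost N d A \<psi>A B \<psi>B \<pi>"
      using perm_dist_attained .
    then show ?thesis
      by (simp add: xy perm_cost_def nonneg sum_nonneg)
  qed
  \<comment> \<open>Membership enters because \<open>d\<close> is known to vanish on the diagonal
    only over \<open>M\<close>.\<close>
  have dist_self: "perm_dist N d x x = 0" if "x \<in> UNIV \<times> (UNIV \<rightarrow> M)" for x
  proof -
    obtain A \<psi> where x: "x = (A, \<psi>)" by (metis surj_pair)
    then have "\<psi> i \<in> M" for i using that by auto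
    then have "perm_cost N d A \<psi> A \<psi> id = 0"
      by (simp add: perm_cost_def perm_matrix_id zero)
    then have "perm_dist N d x x \<le> 0"
      using perm_dist_le[OF bij_id] by (metis x)
    then show ?thesis using dist_nonneg by (intro antisym)
  qed
  \<comment> \<open>Stated for all pairs, so that exchanging \<open>x\<close> and \<open>y\<close>
    yields symmetry.\<close>
  have dist_le: "perm_dist N d y x \<le> perm_dist N d x y" for x y
  proof -
    obtain A \<psi>A B \<psi>B where xy: "x = (A, \<psi>A)" "y = (B, \<psi>B)" by (metis surj_pair)
    obtain \<pi> where "bij \<pi>" "perm_dist N d (A, \<psi>A) (B, \<psi>B) = perm_cost N d A \<psi>A B \<psi>B \<pi>"
      using perm_dist_attained .
    then show ?thesis
      unfolding xy using perm_dist_le[OF bij_imp_bij_inv] perm_cost_inv[of d \<pi>] Met.commute by metis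
  qed
  have dist_triangle: "perm_dist N d x y \<le> perm_dist N d x z + perm_dist N d z y"
    if "x \<in> UNIV \<times> (UNIV \<rightarrow> M)" "y \<in> UNIV \<times> (UNIV \<rightarrow> M)" "z \<in> UNIV \<times> (UNIV \<rightarrow> M)"
    for x y z
  proof -
    obtain A \<psi>A B \<psi>B C \<psi>C where xyz: "x = (A, \<psi>A)" "y = (B, \<psi>B)" "z = (C, \<psi>C)"
      by (metis surj_pair)
    then have M: "\<psi>A i \<in> M" "\<psi>B i \<in> M" "\<psi>C i \<in> M" for i
      using that by auto
    obtain \<pi> where \<pi>: "bij \<pi>" "perm_dist N d (A, \<psi>A) (C, \<psi>C) = perm_cost N d A \<psi>A C \<psi>C \<pi>"
      using perm_dist_attained .
    obtain \<sigma> where \<sigma>: "bij \<sigma>" "perm_dist N d (C, \<psi>C) (B, \<psi>B) = perm_cost N d C \<psi>C B \<psi>B \<sigma>"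
      using perm_dist_attained .
    have "perm_dist N d (A, \<psi>A) (B, \<psi>B) \<le> perm_cost N d A \<psi>A B \<psi>B (\<sigma> \<circ> \<pi>)"
      by (intro perm_dist_le bij_comp \<pi>(1) \<sigma>(1))
    also have "\<dots> \<le> perm_cost N d A \<psi>A C \<psi>C \<pi> + perm_cost N d C \<psi>C B \<psi>B \<sigma>"
      using M by (intro perm_cost_comp Met.triangle \<pi>(1) \<sigma>(1))
    finally show ?thesis by (simp add: xyz \<pi>(2) \<sigma>(2))
  qed
  show ?thesis
    unfolding pseudometric_on_def
    using dist_nonneg dist_self dist_triangle antisym[OF dist_le dist_le] by blast
qed

end

theorem theorem4:
  fixes M :: "'a set" and d :: "'a \<Rightarrow> 'a \<Rightarrow> real"
    and p :: enat and N :: "real ^ 'n ^ 'n \<Rightarrow> real"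
  assumes "Metric_space M d"
    and "1 \<le> p"
    and "N = entrywise_pnorm p \<or> N = operator_pnorm p"
  shows "pseudometric_on ((UNIV :: (real ^ 'n ^ 'n) set) \<times> ((UNIV :: 'n set) \<rightarrow> M)) (perm_dist N d)"
proof -
  have "perm_invariant_seminorm N"
    using assms perm_invariant_seminorm_entrywise perm_invariant_seminorm_operator by blast
  then show ?thesis
    using assms(1) by (rule perm_invariant_seminorm.pseudometric_on_perm_dist)
qed

end
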